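(* Let $N_t,N_r,L\ge1$, $N_0>0$, let $\boldsymbol{\Sigma}_1,\dots,\boldsymbol{\Sigma}_L$ be $N_t\times N_t$ Hermitian positive definite matrices, let $l\in\{1,\dots,L\}$, let $\mathbf{F}_l\in\mathbb{C}^{N_t\times N_t}$, and let $\mathbf{H}_l$ be a random $N_r\times N_t$ complex matrix with $\mathbf{R}_{g,l}=E[\mathbf{H}_l^H\mathbf{H}_l]$ finite and positive definite. With $R_l$, $\mathbf{A}_l,\mathbf{B}_l,\mathbf{C}_l$ as in the context, and $\mathbf{D}_l=\mathbf{B}_l-\mathbf{A}_l^H\mathbf{C}_l^{-1}\mathbf{A}_l$, $$R_l\le R_{{\rm upp},l}=\log_2\det(\boldsymbol{\Sigma}_l)-\log_2\det(\mathbf{C}_l)-\Big[\log_2\det\Big(\mathbf{R}_{g,l}\Big(\mathbf{D}_l+\sum_{t=l+1}^L\boldsymbol{\Sigma}_t\Big)+N_0\mathbf{I}_{N_t}\Big)-\log_2\det\Big(\mathbf{R}_{g,l}\Big(\mathbf{B}_l+\sum_{t=l+1}^L\boldsymbol{\Sigma}_t\Big)+N_0\mathbf{I}_{N_t}\Big)\Big].$$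
   Context: Define $\boldsymbol{\Sigma}_{S,l}=\sum_{t=1}^{l-1}\boldsymbol{\Sigma}_t$ (zero for $l=1$), $\mathbf{A}_l=\mathbf{F}_l\boldsymbol{\Sigma}_{S,l}+\boldsymbol{\Sigma}_l$, $\mathbf{B}_l=\boldsymbol{\Sigma}_{S,l}+\boldsymbol{\Sigma}_l$, $\mathbf{C}_l=\mathbf{F}_l\boldsymbol{\Sigma}_{S,l}\mathbf{F}_l^H+\boldsymbol{\Sigma}_l$, $\boldsymbol{\Sigma}_{Z,l}(\mathbf{H}_l)=\mathbf{H}_l\big(\sum_{t=l+1}^L\boldsymbol{\Sigma}_t\big)\mathbf{H}_l^H+N_0\mathbf{I}_{N_r}$, $\boldsymbol{\Sigma}_{\mathbf{u}_l|\mathbf{y}_l,\mathbf{H}_l}(\mathbf{H}_l)=\mathbf{C}_l-\mathbf{A}_l\mathbf{H}_l^H\big[\mathbf{H}_l\mathbf{B}_l\mathbf{H}_l^H+\boldsymbol{\Sigma}_{Z,l}(\mathbf{H}_l)\big]^{-1}\mathbf{H}_l\mathbf{A}_l^H$, and the linear assignment achievable rate $R_l=\log_2\det(\boldsymbol{\Sigma}_l)-E\big[\log_2\det\boldsymbol{\Sigma}_{\mathbf{u}_l|\mathbf{y}_l,\mathbf{H}_l}(\mathbf{H}_l)\big]$. *)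

theory Defs
  imports "HOL-Analysis.Analysis" "HOL-Probability.Probability"
begin

definition mH :: "complex^'n^'m \<Rightarrow> complex^'m^'n" where
  "mH X = (\<chi> i j. cnj (X $ j $ i))"

definition hpd :: "complex^'n^'n \<Rightarrow> bool" where
  "hpd X \<longleftrightarrow> mH X = X \<and>
     (\<forall>x::complex^'n. x \<noteq> 0 \<longrightarrow> 0 < Re (\<Sum>i\<in>UNIV. cnj (x $ i) * ((X *v x) $ i)))"

(* log2 det of a matrix whose determinant is real and positive *)
definition logdet2 :: "complex^'n^'n \<Rightarrow> real" where
  "logdet2 X = log 2 (Re (det X))"

definition cI :: "complex^'n^'n" where "cI = mat 1"

definition msum :: "(nat \<Rightarrow> complex^'n^'n) \<Rightarrow> nat set \<Rightarrow> complex^'n^'n" where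
  "msum Sig T = (\<Sum>t\<in>T. Sig t)"

definition SigS :: "(nat \<Rightarrow> complex^'n^'n) \<Rightarrow> nat \<Rightarrow> complex^'n^'n" where
  "SigS Sig l = msum Sig {1..<l}"

definition Amat where "Amat Sig F l = F ** SigS Sig l + Sig l"
definition Bmat where "Bmat Sig l = SigS Sig l + Sig l"
definition Cmat where "Cmat Sig F l = F ** SigS Sig l ** mH F + Sig l"
definition Dmat where
  "Dmat Sig F l = Bmat Sig l - mH (Amat Sig F l) ** matrix_inv (Cmat Sig F l) ** Amat Sig F l"

definition SigZ :: "(nat \<Rightarrow> complex^'nt^'nt) \<Rightarrow> nat \<Rightarrow> nat \<Rightarrow> real \<Rightarrow> complex^'nt^'nr \<Rightarrow> complex^'nr^'nr" where
  "SigZ Sig L l N0 H = H ** msum Sig {l+1..L} ** mH H + N0 *\<^sub>R cI"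

definition SigU :: "(nat \<Rightarrow> complex^'nt^'nt) \<Rightarrow> complex^'nt^'nt \<Rightarrow> nat \<Rightarrow> nat \<Rightarrow> real
                      \<Rightarrow> complex^'nt^'nr \<Rightarrow> complex^'nt^'nt" where
  "SigU Sig F L l N0 H = Cmat Sig F l - Amat Sig F l ** mH H **
      matrix_inv (H ** Bmat Sig l ** mH H + SigZ Sig L l N0 H) ** H ** mH (Amat Sig F l)"

definition eexp :: "'w measure \<Rightarrow> ('w \<Rightarrow> real) \<Rightarrow> ereal" where
  "eexp M f = enn2ereal (\<integral>\<^sup>+ w. ennreal (f w) \<partial>M) - enn2ereal (\<integral>\<^sup>+ w. ennreal (- f w) \<partial>M)"

definition Rrate where
  "Rrate M Sig F L l N0 H = ereal (logdet2 (Sig l)) - eexp M (\<lambda>w. logdet2 (SigU Sig F L l N0 (H w)))"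

definition Rg :: "'w measure \<Rightarrow> ('w \<Rightarrow> complex^'nt^'nr) \<Rightarrow> complex^'nt^'nt" where
  "Rg M H = (\<chi> i j. \<integral>w. (mH (H w) ** H w) $ i $ j \<partial>M)"

definition Rupp where
  "Rupp M Sig F L l N0 H = logdet2 (Sig l) - logdet2 (Cmat Sig F l)
     - (logdet2 (Rg M H ** (Dmat Sig F l + msum Sig {l+1..L}) + N0 *\<^sub>R cI)
        - logdet2 (Rg M H ** (Bmat Sig l + msum Sig {l+1..L}) + N0 *\<^sub>R cI))"

end

theory Submission
  imports Defs "HOL-Computational_Algebra.Fundamental_Theorem_Algebra"
begin

text \<open>
  Write \<open>c = N\<^sub>0\<close>, \<open>G = H\<^sup>H H\<close>, \<open>Q = B + (\<Sum>t>l. \<Sigma>\<^sub>t)\<close>, \<open>E = A\<^sup>H C\<^sup>-\<^sup>1 A\<close> and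
  \<open>P = Q - E\<close>. The conditional covariance is \<open>J(G) = C - A (GQ + c)\<^sup>-\<^sup>1 G A\<^sup>H\<close>, and
  Sylvester's determinant identity gives
  \<open>det J(G) = det C * det (GP + c) / det (GQ + c)\<close>. The theorem is therefore Jensen's inequality for
  \<open>G \<mapsto> ln det J(G)\<close> at \<open>G\<^sub>0 = E[G]\<close>, and it suffices to find a supporting hyperplane there.
  By the Woodbury identity \<open>J(G)\<^sup>-\<^sup>1\<close> is explicit, and \<open>ln det X + ln det Y \<le> tr (XY) - n\<close> for
  positive definite \<open>X\<close>, \<open>Y\<close>, applied to \<open>J(G)\<^sup>-\<^sup>1\<close> and \<open>J(G\<^sub>0)\<close>, yields
  \<open>ln det J(G) \<ge> ln det J(G\<^sub>0) - c tr (T (G - G\<^sub>0))\<close> after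
  dropping an error term that is the trace of a product of two positive semidefinite matrices, hence
  nonnegative. No inverse of \<open>P\<close> is needed, which matters because \<open>P\<close> may
  be singular (for \<open>l = L = 1\<close> it is \<open>0\<close>).
\<close>

section \<open>Distributive laws for matrix products, over rings so as to cover polynomial
  entries\<close>

lemma matrix_add_rdistrib: "((A :: 'a::ring_1^'n^'m) + B) ** C = A ** C + B ** C"
  by (vector matrix_matrix_mult_def sum.distrib[symmetric] distrib_right)

lemma matrix_sub_ldistrib: "(A :: 'a::ring_1^'n^'m) ** (B - C) = A ** B - A ** C"
  by (vector matrix_matrix_mult_def sum_subtractf[symmetric] right_diff_distrib)

lemma matrix_sub_rdistrib: "((A :: 'a::ring_1^'n^'m) - B) ** C = A ** C - B ** C"
  by (vector matrix_matrix_mult_def sum_subtractf[symmetric] left_diff_distrib)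

subsection \<open>Determinants and eigenvalues\<close>

lemma poly_det: "poly (det A) s = det (\<chi> i j. poly (A $ i $ j) s)"
  by (simp add: det_def poly_sum poly_prod)

text \<open>Only the identity permutation contributes to the derivative at 0: any other one moves at
  least two rows, so after differentiating one row an off-diagonal zero of the identity matrix
  remains.\<close>

lemma det_one_plus_poly:
  fixes Z :: "complex^'n^'n"
  obtains p where "\<And>t. poly p t = det (mat 1 + (\<chi> i j. t * Z $ i $ j))"
    and "poly (pderiv p) 0 = trace Z"
proof
  let ?A = "(\<chi> i j. [:(mat 1 :: complex^'n^'n) $ i $ j, Z $ i $ j:]) :: complex poly^'n^'n"
  show "poly (det ?A) t = det (mat 1 + (\<chi> i j. t * Z $ i $ j))" for t
    by (simp add: poly_det) (rule arg_cong[where f = det], simp add: vec_eq_iff)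
  \<comment> \<open>\<open>f p\<close> is the product rule at 0 for the term of \<open>p\<close>:
    row \<open>a\<close> gives its linear coefficient, the other rows their constant ones.\<close>
  define f where "f p = (\<Sum>a\<in>UNIV. (\<Prod>i\<in>UNIV - {a}. (mat 1 :: complex^'n^'n) $ i $ p i) * Z $ a $ p a)"
    for p :: "'n \<Rightarrow> 'n"
  have f0: "f p = 0" if p: "p permutes UNIV" "p \<noteq> id" for p
  proof -
    obtain i where i: "p i \<noteq> i" using p by (auto simp: fun_eq_iff)
    then have i': "p (p i) \<noteq> p i"
      using p(1) by (metis permutes_inj injD)
    have "(\<Prod>j\<in>UNIV - {a}. (mat 1 :: complex^'n^'n) $ j $ p j) = 0" for a
      using i i' by (cases "a = i")
        (auto simp: mat_def intro!: prod_zero intro: bexI[of _ i] bexI[of _ "p i"])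
    then show ?thesis by (simp only: f_def mult_zero_left sum.neutral_const)
  qed
  have [simp]: "pderiv (of_int k :: complex poly) = 0" for k
    by (simp add: of_int_poly pderiv_pCons)
  have "poly (pderiv (det ?A)) 0 = (\<Sum>p | p permutes UNIV. of_int (sign p) * f p)"
    by (simp add: det_def higher_pderiv_sum[of 1, simplified] pderiv_mult pderiv_prod poly_sum poly_prod
        f_def pderiv_pCons mult.commute)
  also have "\<dots> = (\<Sum>p\<in>{id}. of_int (sign p) * f p)"
    by (rule sum.mono_neutral_right) (auto simp: permutes_id f0)
  also have "\<dots> = trace Z"
    by (simp add: f_def trace_def mat_def)
  finally show "poly (pderiv (det ?A)) 0 = trace Z" .
qed

text \<open>Matched with \<open>det (1 + t Z)\<close>, the derivative at 0 yields the trace and the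
  value at \<open>t = 1\<close> the determinant.\<close>

lemma prod_list_linear_factors:
  fixes xs :: "complex list"
  shows "poly (\<Prod>x\<leftarrow>xs. [:1, x:]) 0 = 1"
    and "poly (pderiv (\<Prod>x\<leftarrow>xs. [:1, x:])) 0 = sum_list xs"
    and "poly (\<Prod>x\<leftarrow>xs. [:1, x:]) t = (\<Prod>x\<leftarrow>xs. 1 + t * x)"
proof -
  show 0: "poly (\<Prod>x\<leftarrow>xs. [:1, x:]) 0 = 1" for xs :: "complex list"
    by (induction xs) simp_all
  show "poly (pderiv (\<Prod>x\<leftarrow>xs. [:1, x:])) 0 = sum_list xs"
    by (induction xs) (simp_all add: pderiv_mult pderiv_pCons 0 del: mult_pCons_left)
  show "poly (\<Prod>x\<leftarrow>xs. [:1, x:]) t = (\<Prod>x\<leftarrow>xs. 1 + t * x)"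
    by (induction xs) (simp_all add: algebra_simps)
qed

text \<open>The polynomial splits over the complex numbers, and no root \<open>r\<close> is 0
  because the value there is 1. Each factor can thus be rescaled to constant term 1, with
  \<open>x = - 1 / r\<close>.\<close>

lemma poly_factor_at_zero:
  fixes p :: "complex poly"
  assumes "poly p 0 = 1"
  obtains xs where "p = (\<Prod>x\<leftarrow>xs. [:1, x:])" and "\<And>x. x \<in> set xs \<Longrightarrow> x \<noteq> 0 \<and> poly p (- 1 / x) = 0"
proof -
  have p0: "p \<noteq> 0" using assms by auto
  obtain rs where rs: "mset rs = proots p" using ex_mset by blast
  have eq: "p = smult (lead_coeff p) (\<Prod>x\<leftarrow>rs. [:-x, 1:])"
    using complex_poly_decompose_multiset[of p]
    by (simp add: rs[symmetric] prod_mset_prod_list flip: mset_map)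
  have roots: "poly p r = 0" if "r \<in> set rs" for r
  proof -
    have "r \<in># proots p" using that rs by (metis set_mset_mset)
    then show ?thesis using p0 by simp
  qed
  have nz: "r \<noteq> 0" if "r \<in> set rs" for r
    using roots[OF that] assms by auto
  let ?xs = "map (\<lambda>r. - 1 / r) rs"
  have "(\<Prod>x\<leftarrow>rs'. [:-x, 1:]) = smult (\<Prod>x\<leftarrow>rs'. - x) (\<Prod>x\<leftarrow>map (\<lambda>r. - 1 / r) rs'. [:1, x:])"
    if "set rs' \<subseteq> set rs" for rs'
    using that
  proof (induction rs')
    case (Cons a rs')
    have "[:- a, 1:] = smult (- a) [:1, - 1 / a:]" using nz Cons.prems by simp
    moreover have "(\<Prod>x\<leftarrow>rs'. [:- x, 1:]) = smult (\<Prod>x\<leftarrow>rs'. - x) (\<Prod>x\<leftarrow>map (\<lambda>r. - 1 / r) rs'. [:1, x:])"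
      using Cons by auto
    ultimately show ?case
      by (simp only: list.map prod_list.Cons mult_smult_left mult_smult_right smult_smult)
        (simp only: mult.commute)
  qed simp
  from this[of rs] eq have eq2: "p = smult (lead_coeff p * (\<Prod>x\<leftarrow>rs. - x)) (\<Prod>x\<leftarrow>?xs. [:1, x:])"
    by (simp add: mult.commute)
  have "lead_coeff p * (\<Prod>x\<leftarrow>rs. - x) = 1"
    using arg_cong[OF eq2, of "\<lambda>p. poly p 0"] assms
    by (simp add: prod_list_linear_factors(1) del: map_map)
  then have "p = (\<Prod>x\<leftarrow>?xs. [:1, x:])" using eq2 by (metis smult_1_left)
  moreover have "x \<noteq> 0 \<and> poly p (- 1 / x) = 0" if "x \<in> set ?xs" for x
    using that nz roots by auto
  ultimately show ?thesis using that by blast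
qed

text \<open>
  The eigenvalues are read off the factorisation of \<open>t \<mapsto> det (1 + t Z)\<close>, so the list contains only the
  nonzero ones.
\<close>

lemma eigenvalue_list:
  fixes Z :: "complex^'n^'n"
  obtains xs where "trace Z = sum_list xs" and "det (mat 1 + Z) = (\<Prod>x\<leftarrow>xs. 1 + x)"
    and "\<And>x. x \<in> set xs \<Longrightarrow> \<exists>v. v \<noteq> 0 \<and> Z *v v = x *s v"
proof -
  obtain p where p: "\<And>t. poly p t = det (mat 1 + (\<chi> i j. t * Z $ i $ j))"
    and p': "poly (pderiv p) 0 = trace Z"
    using det_one_plus_poly by blast
  have "poly p 0 = 1"
    by (simp add: p flip: zero_vec_def)
  then obtain xs where xs: "p = (\<Prod>x\<leftarrow>xs. [:1, x:])"
    and r: "\<And>x. x \<in> set xs \<Longrightarrow> x \<noteq> 0 \<and> poly p (- 1 / x) = 0"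
    using poly_factor_at_zero by blast
  show ?thesis
  proof
    show "trace Z = sum_list xs" using p' xs prod_list_linear_factors(2) by simp
    have "det (mat 1 + Z) = poly p 1" by (simp add: p)
    then show "det (mat 1 + Z) = (\<Prod>x\<leftarrow>xs. 1 + x)"
      using xs prod_list_linear_factors(3)[where t = 1 and xs = xs] by simp
    fix x assume "x \<in> set xs"
    then have x: "x \<noteq> 0" "poly p (- 1 / x) = 0" using r by auto
    \<comment> \<open>A root \<open>- 1 / x\<close> makes \<open>1 - Z / x\<close> singular, and a
      kernel vector is an eigenvector of \<open>Z\<close> for \<open>x\<close>.\<close>
    let ?W = "mat 1 + (\<chi> i j. (- 1 / x) * Z $ i $ j)"
    have "\<not> invertible ?W" using x(2) by (simp add: p invertible_det_nz)
    then obtain v where v: "v \<noteq> 0" "?W *v v = 0"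
      by (auto simp: invertible_left_inverse matrix_left_invertible_ker)
    have "?W *v v = v - (1 / x) *s (Z *v v)"
      by (simp add: matrix_vector_mult_add_rdistrib)
        (simp add: vec_eq_iff matrix_vector_mult_def sum_distrib_left sum_negf)
    then have "(1 / x) *s (Z *v v) = v" using v(2) by simp
    then have "x *s v = x *s ((1 / x) *s (Z *v v))" by simp
    then have "Z *v v = x *s v" using x(1) by (simp add: vec_eq_iff)
    then show "\<exists>v. v \<noteq> 0 \<and> Z *v v = x *s v" using v(1) by blast
  qed
qed

lemma det_one_minus_mult_commute:
  fixes X Y :: "complex^'n^'n"
  shows "det (mat 1 - X ** Y) = det (mat 1 - Y ** X)"
proof -
  \<comment> \<open>Over the polynomial ring \<open>X + t\<close> has nonzero determinant, which can be cancelled; then set \<open>t = 0\<close>.\<close>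
  define c where "c A = (\<chi> i j. [:A $ i $ j:])" for A :: "complex^'n^'n"
  define X' where "X' = c X + mat [:0, 1:]"
  have ev: "poly (det (mat 1 - X' ** c Y)) 0 = det (mat 1 - X ** Y)"
    "poly (det (mat 1 - c Y ** X')) 0 = det (mat 1 - Y ** X)"
    unfolding poly_det
    by (rule arg_cong[where f = det],
        simp add: vec_eq_iff matrix_matrix_mult_def c_def X'_def poly_sum mat_def
          if_distrib[of "\<lambda>p. poly p _"] mult.commute cong: if_cong)+
  have evX: "poly (det X') s = det (X + mat s)" for s
    unfolding poly_det
    by (rule arg_cong[where f = det], simp add: vec_eq_iff c_def X'_def mat_def)
  \<comment> \<open>For \<open>s\<close> above an operator bound of \<open>X\<close>, the matrix
    \<open>X + s\<close> is injective, so \<open>det X'\<close> is not the zero polynomial.\<close>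
  obtain B where B: "B > 0" "\<And>x. norm (X *v x) \<le> B * norm x"
    using linear_bounded_pos[OF matrix_vector_mul_linear[of X]] by blast
  define s :: complex where "s = of_real (B + 1)"
  have "v = 0" if "(X + mat s) *v v = 0" for v
  proof -
    have "mat s *v v = (B + 1) *\<^sub>R v"
      unfolding vec_eq_iff vector_scaleR_component scaleR_conv_of_real[where 'a = complex] s_def[symmetric]
      by (simp add: matrix_vector_mult_def mat_def if_distrib if_distribR cong: if_cong)
    then have "(X + mat s) *v v = X *v v + (B + 1) *\<^sub>R v"
      by (simp add: matrix_vector_mult_add_rdistrib)
    then have "norm (X *v v) = (B + 1) * norm v"
      using that B(1) by (simp add: eq_neg_iff_add_eq_0[symmetric])
    then show ?thesis using B(2)[of v] by (simp add: algebra_simps)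
  qed
  then have "det (X + mat s) \<noteq> 0"
    by (simp add: invertible_det_nz[symmetric] invertible_left_inverse matrix_left_invertible_ker)
  then have nz: "det X' \<noteq> 0" using evX by (metis poly_0)
  have "(mat 1 - X' ** c Y) ** X' = X' ** (mat 1 - c Y ** X')"
    by (simp add: matrix_sub_rdistrib matrix_sub_ldistrib matrix_mul_assoc)
  then have "det (mat 1 - X' ** c Y) = det (mat 1 - c Y ** X')"
    using nz by (metis det_mul mult.commute mult_cancel_left)
  then show ?thesis using ev by metis
qed

text \<open>This is \<open>ln (1 + x) \<le> x\<close> factor by factor; the witness \<open>r\<close>
  records that the complex product is a positive real.\<close>

lemma ln_prod_list_le:
  assumes "\<And>x. x \<in> set xs \<Longrightarrow> x \<in> \<real> \<and> 0 < 1 + Re x"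
  shows "\<exists>r>0. (\<Prod>x\<leftarrow>xs. 1 + x) = of_real r \<and> ln r \<le> Re (sum_list xs)"
  using assms
proof (induction xs)
  case Nil
  show ?case by (intro exI[of _ 1]) simp
next
  case (Cons x xs)
  then obtain r where r: "r > 0" "(\<Prod>x\<leftarrow>xs. 1 + x) = of_real r" "ln r \<le> Re (sum_list xs)"
    by auto
  have x: "x = of_real (Re x)" "0 < 1 + Re x" using Cons.prems[of x] by (auto simp: complex_is_Real_iff complex_eq_iff)
  have "ln ((1 + Re x) * r) = ln (1 + Re x) + ln r" using x r by (simp add: ln_mult)
  moreover have "ln (1 + Re x) \<le> Re x" using x ln_add_one_self_le_self2[of "Re x"] by simp
  moreover have "1 + x = of_real (1 + Re x)" using x(1) by (metis of_real_1 of_real_add)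
  ultimately show ?case using x r by (intro exI[of _ "(1 + Re x) * r"]) auto
qed

text \<open>The eigenvalue list is taken for \<open>Z - 1\<close>: then \<open>det Z\<close> is the
  product of the \<open>1 + x\<close> and \<open>trace Z - n\<close> the sum of the
  \<open>x\<close>, and omitted zeros affect neither.\<close>

lemma ln_det_le_trace:
  fixes Z :: "complex^'n^'n"
  assumes ev: "\<And>x v. v \<noteq> 0 \<Longrightarrow> Z *v v = x *s v \<Longrightarrow> x \<in> \<real> \<and> 0 < Re x"
  shows "det Z = of_real (Re (det Z))" and "0 < Re (det Z)"
    and "ln (Re (det Z)) \<le> Re (trace Z) - of_nat CARD('n)"
proof -
  obtain xs where xs: "trace (Z - mat 1) = sum_list xs" "det (mat 1 + (Z - mat 1)) = (\<Prod>x\<leftarrow>xs. 1 + x)"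
    and e: "\<And>x. x \<in> set xs \<Longrightarrow> \<exists>v. v \<noteq> 0 \<and> (Z - mat 1) *v v = x *s v"
    using eigenvalue_list[of "Z - mat 1"] by blast
  have "x \<in> \<real> \<and> 0 < 1 + Re x" if x: "x \<in> set xs" for x
  proof -
    obtain v where v: "v \<noteq> 0" "(Z - mat 1) *v v = x *s v" using e[OF x] by blast
    then have "Z *v v = (1 + x) *s v"
      by (simp add: matrix_vector_mult_diff_rdistrib algebra_simps vector_sadd_rdistrib)
    from ev[OF v(1) this] show ?thesis by (auto simp: complex_is_Real_iff)
  qed
  from ln_prod_list_le[of xs, OF this] obtain r where
    r: "r > 0" "(\<Prod>x\<leftarrow>xs. 1 + x) = of_real r" "ln r \<le> Re (sum_list xs)" by blast
  have d: "det Z = of_real r" using xs(2) r(2) by simp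
  have t: "trace Z - of_nat CARD('n) = sum_list xs" using xs(1) by (simp add: trace_sub trace_I)
  show "det Z = of_real (Re (det Z))" "0 < Re (det Z)" using d r by auto
  have "Re (sum_list xs) = Re (trace Z) - of_nat CARD('n)" using t[symmetric] by simp
  then show "ln (Re (det Z)) \<le> Re (trace Z) - of_nat CARD('n)" using d r by simp
qed

subsection \<open>Positive semidefinite matrices\<close>

definition cip :: "complex^'n \<Rightarrow> complex^'n \<Rightarrow> complex" where
  "cip x y = (\<Sum>i\<in>UNIV. cnj (x $ i) * y $ i)"

lemma cip_add_left: "cip (x + y) z = cip x z + cip y z"
  and cip_add_right: "cip x (y + z) = cip x y + cip x z"
  and cip_scale_right: "cip x (a *s y) = a * cip x y"
  and cip_scale_left: "cip (a *s x) y = cnj a * cip x y"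
  and cnj_cip: "cnj (cip x y) = cip y x"
  by (simp_all add: cip_def sum.distrib algebra_simps sum_distrib_left)

lemma Re_cip_self: "Re (cip x x) = (norm x)\<^sup>2"
  by (simp add: cip_def norm_vec_def L2_set_def sum_nonneg cmod_power2)
    (simp add: power2_eq_square)

lemma cip_mH: "cip x (X *v y) = cip (mH X *v x) y"
  by (simp add: cip_def matrix_vector_mult_def mH_def sum_distrib_left sum_distrib_right)
    (subst sum.swap, simp add: mult_ac)

lemma mH_mult: "mH (X ** Y) = mH Y ** mH X"
  by (simp add: mH_def matrix_matrix_mult_def vec_eq_iff mult.commute)

lemma mH_mH [simp]: "mH (mH X) = X"
  and mH_add: "mH (X + Y) = mH X + mH Y"
  and mH_diff: "mH (X - Y) = mH X - mH Y"
  and mH_scaleR: "mH (c *\<^sub>R X) = c *\<^sub>R mH X"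
  and mH_zero [simp]: "mH 0 = 0"
  by (simp_all add: mH_def vec_eq_iff)

lemma mH_one [simp]: "mH (mat 1) = mat 1"
  by (simp add: mH_def mat_def vec_eq_iff)

lemma mult_scaleR_matrix:
  fixes A :: "complex^'n^'m"
  shows "(k *\<^sub>R A) ** B = k *\<^sub>R (A ** B)" and "A ** (k *\<^sub>R B) = k *\<^sub>R (A ** B)"
  by (simp_all add: scalar_matrix_assoc matrix_scalar_ac)

lemma matrix_inv_cancel:
  fixes X :: "complex^'n^'n"
  assumes "det X \<noteq> 0"
  shows "X ** matrix_inv X = mat 1" and "matrix_inv X ** X = mat 1"
proof -
  have "invertible X" using assms by (simp add: invertible_det_nz)
  then have "\<exists>Y. X ** Y = mat 1 \<and> Y ** X = mat 1" by (simp add: invertible_def)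
  from someI_ex[OF this] show "X ** matrix_inv X = mat 1" "matrix_inv X ** X = mat 1"
    by (simp_all add: matrix_inv_def)
qed

lemma matrix_inverse_unique:
  fixes X :: "complex^'n^'n"
  assumes "X ** Y = mat 1"
  shows "matrix_inv X = Y"
proof -
  have "det X * det Y = 1" using assms by (metis det_I det_mul)
  then have "det X \<noteq> 0" by auto
  then have "matrix_inv X ** (X ** Y) = Y" by (simp add: matrix_mul_assoc matrix_inv_cancel)
  then show ?thesis using assms by simp
qed

lemma mH_matrix_inv:
  fixes X :: "complex^'n^'n"
  assumes "det X \<noteq> 0"
  shows "mH (matrix_inv X) = matrix_inv (mH X)"
proof -
  have "mH X ** mH (matrix_inv X) = mat 1"
    using assms by (simp add: matrix_inv_cancel flip: mH_mult)
  then show ?thesis by (rule matrix_inverse_unique[symmetric])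
qed

text \<open>The weak form of \<open>hpd\<close>, suited to Schur complements and Gram matrices,
  which may be singular.\<close>

definition psd :: "complex^'n^'n \<Rightarrow> bool" where
  "psd X \<longleftrightarrow> mH X = X \<and> (\<forall>x. 0 \<le> Re (cip x (X *v x)))"

lemma psdD: "psd X \<Longrightarrow> mH X = X" "psd X \<Longrightarrow> 0 \<le> Re (cip x (X *v x))"
  by (auto simp: psd_def)

lemma hpd_iff: "hpd X \<longleftrightarrow> mH X = X \<and> (\<forall>x. x \<noteq> 0 \<longrightarrow> 0 < Re (cip x (X *v x)))"
  by (simp add: hpd_def cip_def)

lemma hpd_imp_psd: "hpd X \<Longrightarrow> psd X"
proof -
  assume X: "hpd X"
  have "0 \<le> Re (cip x (X *v x))" for x
    using X by (cases "x = 0") (auto simp: hpd_iff cip_def less_imp_le)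
  then show ?thesis using X by (simp add: hpd_iff psd_def)
qed

lemma psd_add: "psd X \<Longrightarrow> psd Y \<Longrightarrow> psd (X + Y)"
  by (simp add: psd_def mH_add matrix_vector_mult_add_rdistrib cip_add_right)

lemma hpd_add: "hpd X \<Longrightarrow> psd Y \<Longrightarrow> hpd (X + Y)"
  by (auto simp: psd_def hpd_iff mH_add matrix_vector_mult_add_rdistrib cip_add_right intro: add_pos_nonneg)

lemma psd_zero: "psd 0"
  by (simp add: psd_def) (simp add: cip_def)

lemma psd_sum: "(\<And>t. t \<in> T \<Longrightarrow> psd (f t)) \<Longrightarrow> psd (sum f T)"
  by (induction T rule: infinite_finite_induct) (auto intro: psd_add simp: psd_zero)

lemma scaleR_matrix_vector_mult:
  fixes X :: "complex^'n^'m"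
  shows "(c *\<^sub>R X) *v x = of_real c *s (X *v x)"
proof -
  have "((c *\<^sub>R X) *v x) $ i = (of_real c *s (X *v x)) $ i" for i
    unfolding matrix_vector_mult_def vector_scaleR_component vec_lambda_beta vector_smult_component
    by (simp only: sum_distrib_left scaleR_conv_of_real[where 'a = complex] mult.assoc)
  then show ?thesis by (simp add: vec_eq_iff)
qed

lemma psd_scaleR: "0 \<le> c \<Longrightarrow> psd X \<Longrightarrow> psd (c *\<^sub>R X)"
  by (simp add: psd_def mH_scaleR cip_scale_right scaleR_matrix_vector_mult)

lemma psd_congruence:
  fixes X :: "complex^'n^'n" and T :: "complex^'n^'m"
  assumes "psd X"
  shows "psd (T ** X ** mH T)"
  unfolding psd_def
proof (intro conjI allI)
  show "mH (T ** X ** mH T) = T ** X ** mH T"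
    using assms by (simp add: mH_mult psdD matrix_mul_assoc)
  fix x
  have "cip x ((T ** X ** mH T) *v x) = cip (mH T *v x) (X *v (mH T *v x))"
    by (simp only: cip_mH[of x T, symmetric] matrix_vector_mul_assoc matrix_mul_assoc)
  then show "0 \<le> Re (cip x ((T ** X ** mH T) *v x))"
    using assms by (simp add: psdD)
qed

lemma psd_one: "psd (mat 1)"
  by (simp add: psd_def Re_cip_self)

lemma psd_gram: "psd (mH T ** T)"
  using psd_congruence[OF psd_one, of "mH T"] by simp

lemma cip_hermitian_real: "mH X = X \<Longrightarrow> cip x (X *v x) = of_real (Re (cip x (X *v x)))"
  using cnj_cip[of x "X *v x"] cip_mH[of x X x] by (simp add: complex_eq_iff)

text \<open>If \<open>y = X x\<close> were nonzero, moving from \<open>x\<close> a little in the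
  direction \<open>- y\<close> would make the quadratic form negative.\<close>

lemma psd_kernel:
  assumes X: "psd X" and z: "Re (cip x (X *v x)) = 0"
  shows "X *v x = 0"
proof (rule ccontr)
  assume nz: "X *v x \<noteq> 0"
  define y where "y = X *v x"
  define a b where "a = (norm y)\<^sup>2" and "b = Re (cip y (X *v y))"
  have a: "a > 0" using nz by (simp add: a_def y_def)
  have b: "b \<ge> 0" using X by (simp add: b_def psdD)
  have c: "cip x (X *v y) = cip y y" using X by (simp add: cip_mH psdD y_def)
  have "0 \<le> t\<^sup>2 * b + 2 * t * a" for t :: real
  proof -
    have "0 \<le> Re (cip (x + of_real t *s y) (X *v (x + of_real t *s y)))" using X by (rule psdD)
    also have "\<dots> = t\<^sup>2 * b + 2 * t * a"
      using z c Re_cip_self[of y]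
      by (simp add: matrix_vector_right_distrib cip_add_left cip_add_right vector_scalar_commute
          cip_scale_left cip_scale_right a_def b_def power2_eq_square algebra_simps flip: y_def)
    finally show ?thesis .
  qed
  \<comment> \<open>The \<open>+ 1\<close> keeps the denominator positive when
    \<open>b = 0\<close>.\<close>
  from this[of "- a / (b + 1)"] have "0 \<le> (a / (b + 1))\<^sup>2 * b - 2 * (a / (b + 1)) * a" by simp
  also have "\<dots> = (a / (b + 1))\<^sup>2 * (b - 2 * (b + 1))"
    using b by (simp add: power2_eq_square divide_simps) (simp add: algebra_simps)
  also have "\<dots> < 0" using a b by (intro mult_pos_neg) auto
  finally show False by simp
qed

section \<open>Spectrum, trace and determinant of products of positive semidefinite matrices\<close>

text \<open>With \<open>w = K v\<close> and \<open>S w = x v\<close>, pairing with \<open>w\<close>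
  gives \<open>cip w (S w) = x * cip v (K v)\<close>. For \<open>x \<noteq> 0\<close> this exhibits
  \<open>x\<close> as a quotient of nonnegative reals, with nonzero denominator by
  \<open>psd_kernel\<close>.\<close>

lemma eigenvalue_psd_mult:
  fixes S K :: "complex^'n^'n"
  assumes S: "psd S" and K: "psd K" and v: "v \<noteq> 0" and e: "(S ** K) *v v = x *s v"
  shows "x \<in> \<real> \<and> 0 \<le> Re x"
proof (cases "x = 0")
  case False
  let ?w = "K *v v"
  define a k where "a = Re (cip ?w (S *v ?w))" and "k = Re (cip v ?w)"
  have ew: "S *v ?w = x *s v" using e by (simp add: matrix_vector_mul_assoc)
  have w: "?w \<noteq> 0" using ew False v by auto
  have "k \<ge> 0" using K by (simp add: k_def psdD)
  moreover have "k \<noteq> 0" using psd_kernel[OF K] w by (auto simp: k_def)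
  ultimately have k: "k > 0" by simp
  have a: "a \<ge> 0" using S by (simp add: a_def psdD)
  have "of_real a = cip ?w (S *v ?w)" unfolding a_def
    by (rule cip_hermitian_real[symmetric, OF psdD(1)[OF S]])
  also have "\<dots> = x * cip ?w v" by (simp add: ew cip_scale_right)
  also have "cip ?w v = cip v ?w" using cip_mH[of v K v] psdD(1)[OF K] by simp
  also have "\<dots> = of_real k" unfolding k_def
    by (rule cip_hermitian_real[OF psdD(1)[OF K]])
  finally have "x = of_real (a / k)" using k by (simp add: field_simps)
  then show ?thesis using a k by simp
qed simp

lemma trace_psd_mult_nonneg:
  fixes S K :: "complex^'n^'n"
  assumes "psd S" "psd K"
  shows "0 \<le> Re (trace (S ** K))"
proof -
  obtain xs where xs: "trace (S ** K) = sum_list xs" "det (mat 1 + S ** K) = (\<Prod>x\<leftarrow>xs. 1 + x)"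
    and e: "\<And>x. x \<in> set xs \<Longrightarrow> \<exists>v. v \<noteq> 0 \<and> (S ** K) *v v = x *s v"
    using eigenvalue_list[of "S ** K"] by blast
  have "0 \<le> Re x" if x: "x \<in> set xs" for x
  proof -
    obtain v where "v \<noteq> 0" "(S ** K) *v v = x *s v" using e[OF x] by blast
    then show ?thesis using eigenvalue_psd_mult[OF assms, of v x] by simp
  qed
  then have "0 \<le> Re (sum_list xs)" by (induction xs) auto
  then show ?thesis by (simp add: xs)
qed

text \<open>Every eigenvalue of \<open>G P + c\<close> is a nonnegative eigenvalue of
  \<open>G P\<close> shifted by \<open>c\<close>. Realness ensures that \<open>logdet2\<close>,
  which sees only the real part, sees the whole determinant.\<close>

lemma det_psd_mult_plus_pos:
  fixes G P :: "complex^'n^'n"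
  assumes "psd G" "psd P" "0 < c"
  shows "0 < Re (det (G ** P + c *\<^sub>R mat 1))"
    and "det (G ** P + c *\<^sub>R mat 1) = of_real (Re (det (G ** P + c *\<^sub>R mat 1)))"
proof -
  have *: "x \<in> \<real> \<and> 0 < Re x" if "v \<noteq> 0" "(G ** P + c *\<^sub>R mat 1) *v v = x *s v" for x v
  proof -
    have "(c *\<^sub>R mat 1) *v v = of_real c *s v"
      by (simp add: scaleR_matrix_vector_mult)
    then have "(G ** P) *v v = x *s v - of_real c *s v"
      using that(2) by (metis add_diff_cancel_right' matrix_vector_mult_add_rdistrib)
    also have "\<dots> = (x - of_real c) *s v" by (simp add: vec_eq_iff left_diff_distrib)
    finally have "(G ** P) *v v = (x - of_real c) *s v" .
    from eigenvalue_psd_mult[OF assms(1,2) that(1) this] assms(3)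
    show ?thesis by (auto simp: complex_is_Real_iff)
  qed
  show "0 < Re (det (G ** P + c *\<^sub>R mat 1))"
    by (rule ln_det_le_trace) (rule *)
  show "det (G ** P + c *\<^sub>R mat 1) = of_real (Re (det (G ** P + c *\<^sub>R mat 1)))"
    by (rule ln_det_le_trace) (rule *)
qed

lemma eigenvalue_hpd_mult:
  fixes A B :: "complex^'n^'n"
  assumes A: "hpd A" and B: "hpd B" and v: "v \<noteq> 0" and e: "(A ** B) *v v = x *s v"
  shows "x \<in> \<real> \<and> 0 < Re x"
proof -
  have r: "x \<in> \<real> \<and> 0 \<le> Re x"
    by (rule eigenvalue_psd_mult[OF hpd_imp_psd[OF A] hpd_imp_psd[OF B] v e])
  have "x \<noteq> 0"
  proof
    assume "x = 0"
    then have "A *v (B *v v) = 0" using e by (simp add: matrix_vector_mul_assoc)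
    then have "B *v v = 0" using A by (auto simp: hpd_iff cip_def)
    then show False using B v by (auto simp: hpd_iff cip_def)
  qed
  then show ?thesis using r by (auto simp: complex_is_Real_iff complex_eq_iff)
qed

lemma hpd_one: "hpd (mat 1)"
  by (simp add: hpd_iff Re_cip_self)

lemma hpd_det:
  assumes "hpd A"
  shows "det A = of_real (Re (det A))" and "0 < Re (det A)"
proof -
  have *: "x \<in> \<real> \<and> 0 < Re x" if "v \<noteq> 0" "A *v v = x *s v" for x v
    using that by (intro eigenvalue_hpd_mult[OF assms hpd_one, of v]) simp_all
  show "det A = of_real (Re (det A))" by (rule ln_det_le_trace) (rule *)
  show "0 < Re (det A)" by (rule ln_det_le_trace) (rule *)
qed

text \<open>The product need not be Hermitian, but its eigenvalues are positive, so
  \<open>ln_det_le_trace\<close> applies. Equality holds for mutually inverse matrices, which later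
  makes the bound tangent.\<close>

lemma ln_det_hpd_pair:
  fixes A B :: "complex^'n^'n"
  assumes "hpd A" "hpd B"
  shows "ln (Re (det A)) + ln (Re (det B)) \<le> Re (trace (A ** B)) - of_nat CARD('n)"
proof -
  have "Re (det (A ** B)) = Re (det A) * Re (det B)"
    by (subst det_mul, subst hpd_det(1)[OF assms(1)], subst hpd_det(1)[OF assms(2)]) simp
  then have "ln (Re (det A)) + ln (Re (det B)) = ln (Re (det (A ** B)))"
    using hpd_det(2)[OF assms(1)] hpd_det(2)[OF assms(2)] by (simp add: ln_mult)
  also have "\<dots> \<le> Re (trace (A ** B)) - of_nat CARD('n)"
    by (rule ln_det_le_trace) (rule eigenvalue_hpd_mult[OF assms])
  finally show ?thesis .
qed

lemma hpd_inverse: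
  fixes X :: "complex^'n^'n"
  assumes "hpd X" "X ** Y = mat 1"
  shows "hpd Y"
proof -
  have Y: "Y = matrix_inv X" using matrix_inverse_unique[OF assms(2)] by simp
  have nz: "det X \<noteq> 0" using hpd_det(2)[OF assms(1)] by auto
  have h: "mH Y = Y" using nz assms(1) by (simp add: Y mH_matrix_inv hpd_iff)
  have "0 < Re (cip x (Y *v x))" if "x \<noteq> 0" for x
  proof -
    have x: "X *v (Y *v x) = x" by (simp add: matrix_vector_mul_assoc assms(2))
    then have "Y *v x \<noteq> 0" using that by auto
    then have "0 < Re (cip (Y *v x) (X *v (Y *v x)))" using assms(1) by (simp add: hpd_iff)
    also have "\<dots> = Re (cip x (Y *v x))" by (simp add: x cip_mH h)
    finally show ?thesis .
  qed
  then show ?thesis using h by (simp add: hpd_iff)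
qed

lemmas matrix_ring_simps = matrix_add_ldistrib matrix_add_rdistrib matrix_sub_ldistrib
  matrix_sub_rdistrib mult_scaleR_matrix matrix_mul_assoc

subsection \<open>The supporting hyperplane\<close>

text \<open>The resolvent of the product \<open>G P\<close> at \<open>- c\<close>; for positive
  semidefinite arguments, exchanging them amounts to taking the adjoint.\<close>

definition resolvent :: "real \<Rightarrow> complex^'n^'n \<Rightarrow> complex^'n^'n \<Rightarrow> complex^'n^'n" where
  "resolvent c G P = matrix_inv (G ** P + c *\<^sub>R mat 1)"

lemma resolvent_cancel:
  assumes "psd G" "psd P" "0 < c"
  shows "(G ** P + c *\<^sub>R mat 1) ** resolvent c G P = mat 1"
    and "resolvent c G P ** (G ** P + c *\<^sub>R mat 1) = mat 1"
proof -
  have "det (G ** P + c *\<^sub>R mat 1) \<noteq> 0" using det_psd_mult_plus_pos(1)[OF assms] by auto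
  then show "(G ** P + c *\<^sub>R mat 1) ** resolvent c G P = mat 1"
    and "resolvent c G P ** (G ** P + c *\<^sub>R mat 1) = mat 1"
    by (simp_all add: resolvent_def matrix_inv_cancel)
qed

lemma mH_resolvent:
  assumes "psd G" "psd P" "0 < c"
  shows "mH (resolvent c G P) = resolvent c P G"
proof -
  have "det (G ** P + c *\<^sub>R mat 1) \<noteq> 0" using det_psd_mult_plus_pos(1)[OF assms] by auto
  then show ?thesis using assms
    by (simp add: resolvent_def mH_matrix_inv mH_add mH_mult mH_scaleR psdD)
qed

lemma resolvent_push:
  assumes "psd G" "psd P" "0 < c"
  shows "resolvent c G P ** G = G ** resolvent c P G"
proof -
  let ?M = "G ** P + c *\<^sub>R mat 1" and ?M' = "P ** G + c *\<^sub>R mat 1"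
  have "?M ** G = G ** ?M'" by (simp add: matrix_ring_simps)
  then have "resolvent c G P ** (?M ** G) ** resolvent c P G = resolvent c G P ** (G ** ?M') ** resolvent c P G" by simp
  then have "(resolvent c G P ** ?M) ** G ** resolvent c P G = resolvent c G P ** G ** (?M' ** resolvent c P G)"
    by (simp only: matrix_mul_assoc)
  then show ?thesis using assms by (simp add: resolvent_cancel)
qed

text \<open>With \<open>R = resolvent c G P\<close>, the product \<open>R G\<close> equals the
  congruence \<open>R (G P G + c G) (mH R)\<close>, since \<open>G P G + c G = G (P G + c)\<close>
  and \<open>P G + c\<close> cancels \<open>mH R\<close>.\<close>

lemma psd_resolvent:
  assumes "psd G" "psd P" "0 < c"
  shows "psd (resolvent c G P ** G)"
proof -
  let ?M' = "P ** G + c *\<^sub>R mat 1"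
  have "psd (G ** P ** G)" using psd_congruence[OF assms(2), of G] assms(1) by (simp add: psdD)
  then have "psd (G ** P ** G + c *\<^sub>R G)" using assms by (intro psd_add psd_scaleR) auto
  then have "psd (resolvent c G P ** (G ** P ** G + c *\<^sub>R G) ** mH (resolvent c G P))" by (rule psd_congruence)
  moreover have "resolvent c G P ** (G ** P ** G + c *\<^sub>R G) = resolvent c G P ** G ** ?M'"
    by (simp add: matrix_ring_simps)
  ultimately have "psd (resolvent c G P ** G ** (?M' ** resolvent c P G))"
    using assms by (simp add: mH_resolvent matrix_mul_assoc)
  then show ?thesis using assms by (simp add: resolvent_cancel)
qed

lemma hpd_inv:
  assumes "hpd C"
  shows "hpd (matrix_inv C)" and "C ** matrix_inv C = mat 1" and "matrix_inv C ** C = mat 1"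
proof -
  have nz: "det C \<noteq> 0" using hpd_det(2)[OF assms] by auto
  then show "C ** matrix_inv C = mat 1" "matrix_inv C ** C = mat 1" by (rule matrix_inv_cancel)+
  then show "hpd (matrix_inv C)" using assms hpd_inverse by blast
qed

section \<open>Schur complements: inverse, determinant and tangent\<close>

text \<open>Woodbury's formula. \<open>Y\<close> is positive definite as \<open>matrix_inv C\<close>
  plus a congruence, and the error terms of the product cancel by the resolvent identity
  \<open>N\<close>.\<close>

lemma schur_inverse:
  fixes A C Q P X :: "complex^'n^'n"
  assumes C: "hpd C" and Q: "psd Q" and P: "psd P" "P = Q - mH A ** matrix_inv C ** A"
    and X: "psd X" and c: "0 < c"
  defines "Y \<equiv> matrix_inv C + matrix_inv C ** A ** (resolvent c X P ** X) ** mH A ** matrix_inv C"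
  shows "hpd Y" and "(C - A ** (resolvent c X Q ** X) ** mH A) ** Y = mat 1"
proof -
  let ?Ci = "matrix_inv C" and ?N = "resolvent c X P ** X" and ?Nq = "resolvent c X Q ** X"
  note Ci = hpd_inv[OF C]
  have h: "mH ?Ci = ?Ci" using Ci(1) by (simp add: hpd_iff)
  have "psd ((?Ci ** A) ** ?N ** mH (?Ci ** A))"
    by (rule psd_congruence, rule psd_resolvent) fact+
  then have "psd (?Ci ** A ** ?N ** mH A ** ?Ci)" by (simp add: mH_mult h matrix_mul_assoc)
  then show "hpd Y" unfolding Y_def using Ci(1) by (intro hpd_add)
  let ?E = "mH A ** ?Ci ** A"
  have N: "?N - ?Nq = ?Nq ** ?E ** ?N"
  proof -
    \<comment> \<open>Identities are inserted on both sides so that only the difference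
      \<open>X (Q - P)\<close> of the two inverted matrices survives.\<close>
    have "?N - ?Nq = (resolvent c X Q ** (X ** Q + c *\<^sub>R mat 1)) ** ?N
        - resolvent c X Q ** ((X ** P + c *\<^sub>R mat 1) ** resolvent c X P) ** X"
      using X P(1) Q c by (simp add: resolvent_cancel)
    also have "\<dots> = resolvent c X Q ** X ** (Q - P) ** ?N"
      by (simp add: matrix_ring_simps)
    also have "Q - P = ?E" using P(2) by simp
    finally show ?thesis .
  qed
  have "(C - A ** ?Nq ** mH A) ** Y = C ** ?Ci + (C ** ?Ci) ** A ** ?N ** mH A ** ?Ci
     - A ** ?Nq ** mH A ** ?Ci - A ** (?Nq ** ?E ** ?N) ** mH A ** ?Ci"
    by (simp add: Y_def matrix_ring_simps)
  also have "\<dots> = mat 1"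
    by (simp only: Ci N[symmetric]) (simp add: matrix_ring_simps)
  finally show "(C - A ** ?Nq ** mH A) ** Y = mat 1" .
qed

text \<open>Positivity of this difference is read off from its inverse, which is a sum of positive
  terms.\<close>

lemma schur_hpd:
  fixes A C Q P X :: "complex^'n^'n"
  assumes "hpd C" "psd Q" "psd P" "P = Q - mH A ** matrix_inv C ** A" "psd X" "0 < c"
  shows "hpd (C - A ** (resolvent c X Q ** X) ** mH A)"
proof -
  note * = schur_inverse[OF assms]
  from *(2) have "(matrix_inv C + matrix_inv C ** A ** (resolvent c X P ** X) ** mH A ** matrix_inv C)
      ** (C - A ** (resolvent c X Q ** X) ** mH A) = mat 1"
    by (simp add: matrix_left_right_inverse)
  then show ?thesis using *(1) hpd_inverse by blast
qed

text \<open>After factoring out \<open>C\<close>, Sylvester's identity turns the rest into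
  \<open>det (1 - N E)\<close>, and
  \<open>(G Q + c) (1 - N E) = G Q + c - G E = G P + c\<close>.\<close>

lemma schur_det:
  fixes A C Q P G :: "complex^'n^'n"
  assumes C: "hpd C" and Q: "psd Q" and P: "psd P" "P = Q - mH A ** matrix_inv C ** A"
    and G: "psd G" and c: "0 < c"
  shows "ln (Re (det (C - A ** (resolvent c G Q ** G) ** mH A))) = ln (Re (det C))
    + (ln (Re (det (G ** P + c *\<^sub>R mat 1))) - ln (Re (det (G ** Q + c *\<^sub>R mat 1))))"
proof -
  let ?Ci = "matrix_inv C" and ?N = "resolvent c G Q ** G" and ?E = "mH A ** matrix_inv C ** A"
  let ?S = "C - A ** ?N ** mH A"
  let ?MP = "G ** P + c *\<^sub>R mat 1" and ?MQ = "G ** Q + c *\<^sub>R mat 1"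
  have "?S = C - (C ** ?Ci) ** A ** ?N ** mH A"
    by (simp add: hpd_inv[OF C])
  also have "\<dots> = C ** (mat 1 - (?Ci ** A) ** (?N ** mH A))"
    by (simp add: matrix_ring_simps)
  finally have "det ?S = det C * det (mat 1 - (?N ** mH A) ** (?Ci ** A))"
    by (simp add: det_mul det_one_minus_mult_commute)
  then have S: "det ?S = det C * det (mat 1 - ?N ** ?E)"
    by (simp add: matrix_mul_assoc)
  have "?MQ ** (mat 1 - ?N ** ?E) = ?MQ - (?MQ ** resolvent c G Q) ** G ** ?E"
    by (simp only: matrix_sub_ldistrib matrix_mul_assoc matrix_mul_rid)
  also have "\<dots> = ?MP"
    using G Q c by (simp add: resolvent_cancel P(2)) (simp add: matrix_ring_simps)
  finally have "det ?MQ * det (mat 1 - ?N ** ?E) = det ?MP"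
    by (metis det_mul)
  with S have eq: "det ?S * det ?MQ = det C * det ?MP" by (simp add: mult_ac)
  note r = hpd_det[OF schur_hpd[OF assms]] det_psd_mult_plus_pos[OF G P(1) c]
    det_psd_mult_plus_pos[OF G Q c] hpd_det[OF C]
  \<comment> \<open>All four determinants are real, so the complex identity passes to real
    parts.\<close>
  have "of_real (Re (det ?S) * Re (det ?MQ)) = (of_real (Re (det C) * Re (det ?MP)) :: complex)"
    unfolding of_real_mult r(1,4,6,7)[symmetric] by (rule eq)
  then have "Re (det ?S) * Re (det ?MQ) = Re (det C) * Re (det ?MP)" by (simp only: of_real_eq_iff)
  then have "ln (Re (det ?S)) + ln (Re (det ?MQ)) = ln (Re (det C)) + ln (Re (det ?MP))"
    using r(2,3,5,8) by (metis ln_mult_pos)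
  then show ?thesis by simp
qed

text \<open>The minorant is affine in \<open>G\<close> and exact at \<open>G0\<close>. Its slope may
  involve only \<open>G0\<close>, for then the linear term vanishes on averaging; hence the
  replacement of \<open>U\<close> by \<open>U0\<close> below.\<close>

lemma schur_tangent:
  fixes A C Q P G G0 :: "complex^'n^'n"
  assumes C: "hpd C" and Q: "psd Q" and P: "psd P" "P = Q - mH A ** matrix_inv C ** A"
    and G: "psd G" and G0: "psd G0" and c: "0 < c"
  defines "E \<equiv> mH A ** matrix_inv C ** A"
  shows "ln (Re (det (C - A ** (resolvent c G0 Q ** G0) ** mH A)))
     - c * Re (trace (resolvent c Q G0 ** E ** resolvent c G0 P ** (G - G0)))
    \<le> ln (Re (det (C - A ** (resolvent c G Q ** G) ** mH A)))"
proof -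
  let ?Ci = "matrix_inv C"
  define N N0 where "N = resolvent c G P ** G" and "N0 = resolvent c G0 Q ** G0"
  define X where "X = G - G0"
  define U U0 V0 where "U = resolvent c G P" and "U0 = resolvent c G0 P" and "V0 = resolvent c Q G0"
  define Y where "Y = ?Ci + ?Ci ** A ** N ** mH A ** ?Ci"
  define Sg where "Sg = C - A ** (resolvent c G Q ** G) ** mH A"
  define Sg0 where "Sg0 = C - A ** N0 ** mH A"
  note U = resolvent_cancel[OF G P(1) c, folded U_def]
  note U0 = resolvent_cancel[OF G0 P(1) c, folded U0_def]
  note V0 = resolvent_cancel[OF Q G0 c, folded V0_def]
  have N0: "N0 = G0 ** V0" unfolding N0_def V0_def by (rule resolvent_push[OF G0 Q c])
  have PE: "P = Q - E" using P(2) by (simp add: E_def)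
  have hY: "hpd Y" and SY: "Sg ** Y = mat 1"
    unfolding Y_def N_def Sg_def by (rule schur_inverse[OF C Q P G c])+
  have hS: "hpd Sg" unfolding Sg_def by (rule schur_hpd[OF C Q P G c])
  have hS0: "hpd Sg0" unfolding Sg0_def N0_def by (rule schur_hpd[OF C Q P G0 c])
  have "of_real (Re (det Sg)) * of_real (Re (det Y)) = (1::complex)"
    unfolding hpd_det(1)[OF hS, symmetric] hpd_det(1)[OF hY, symmetric]
    using SY by (metis det_I det_mul)
  then have "Re (det Sg) * Re (det Y) = 1" by (metis of_real_1 of_real_eq_iff of_real_mult)
  then have "ln (Re (det Sg)) + ln (Re (det Y)) = 0"
    using hpd_det(2)[OF hS] hpd_det(2)[OF hY] by (metis ln_mult_pos ln_one)
  moreover have "ln (Re (det Y)) + ln (Re (det Sg0)) \<le> Re (trace (Y ** Sg0)) - of_nat CARD('n)"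
    by (rule ln_det_hpd_pair[OF hY hS0])
  moreover have "trace (Y ** Sg0) - of_nat CARD('n) = of_real c * trace (V0 ** E ** U ** X)"
  proof -
    have "Y ** Sg0 = ?Ci ** C + ?Ci ** A ** N ** mH A ** (?Ci ** C) - ?Ci ** A ** N0 ** mH A
        - ?Ci ** A ** N ** E ** N0 ** mH A"
      by (simp add: Y_def Sg0_def E_def matrix_ring_simps)
    also have "\<dots> = mat 1 + ?Ci ** A ** ((N - N0 - N ** E ** N0) ** mH A)"
      unfolding hpd_inv(3)[OF C] by (simp add: matrix_ring_simps)
    finally have "trace (Y ** Sg0) = of_nat CARD('n) + trace ((N - N0 - N ** E ** N0) ** mH A ** (?Ci ** A))"
      by (simp add: trace_add trace_I trace_mul_sym[of "?Ci ** A"])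
    also have "(N - N0 - N ** E ** N0) ** mH A ** (?Ci ** A) = (N - N0 - N ** E ** N0) ** E"
      by (simp only: E_def matrix_mul_assoc)
    also have "N - N0 - N ** E ** N0 = c *\<^sub>R (U ** X ** V0)"
    \<comment> \<open>Inserting \<open>(Q G0 + c) V0 = 1\<close> after \<open>N\<close> lets
      \<open>Q - E\<close> merge into \<open>P\<close>; then \<open>U (G P + c) = 1\<close> leaves
      only \<open>c\<close> times \<open>X = G - G0\<close>.\<close>
    proof -
      have "N - N0 - N ** E ** N0 = N ** ((Q ** G0 + c *\<^sub>R mat 1) ** V0) - G0 ** V0 - N ** E ** G0 ** V0"
        by (simp add: V0 N0 matrix_mul_assoc)
      also have "\<dots> = (N ** (P ** G0 + c *\<^sub>R mat 1) - G0) ** V0"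
        by (simp add: PE matrix_ring_simps)
      also have "N ** (P ** G0 + c *\<^sub>R mat 1) - G0
         = U ** G ** (P ** G0 + c *\<^sub>R mat 1) - (U ** (G ** P + c *\<^sub>R mat 1)) ** G0"
        by (simp only: U) (simp add: N_def U_def)
      also have "\<dots> = c *\<^sub>R (U ** X)"
        by (simp add: X_def matrix_ring_simps scaleR_diff_right)
      finally show ?thesis by (simp add: matrix_ring_simps)
    qed
    also have "trace (c *\<^sub>R (U ** X ** V0) ** E) = of_real c * trace (U ** X ** (V0 ** E))"
      by (simp add: mult_scaleR_matrix matrix_mul_assoc)
        (simp add: trace_def scaleR_conv_of_real[where 'a = complex] sum_distrib_left)
    also have "trace (U ** X ** (V0 ** E)) = trace (V0 ** E ** (U ** X))" by (rule trace_mul_sym)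
    finally show ?thesis by (simp add: matrix_mul_assoc)
  qed
  moreover have "Re (trace (V0 ** E ** U ** X)) \<le> Re (trace (V0 ** E ** U0 ** X))"
  proof -
    \<comment> \<open>The resolvent identity makes the replacement error a trace of
      \<open>V0 E U0\<close> times \<open>X (P U) X\<close>; both factors turn out positive
      semidefinite.\<close>
    have "U0 - U = U0 ** ((G ** P + c *\<^sub>R mat 1) ** U) - (U0 ** (G0 ** P + c *\<^sub>R mat 1)) ** U"
      by (simp add: U U0)
    also have "\<dots> = U0 ** X ** P ** U" by (simp add: X_def matrix_ring_simps)
    finally have "V0 ** E ** (U0 - U) ** X = (V0 ** E ** U0) ** (X ** (P ** U) ** X)"
      by (simp only: matrix_mul_assoc)
    then have tr: "trace (V0 ** E ** U0 ** X) - trace (V0 ** E ** U ** X)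
       = trace ((V0 ** E ** U0) ** (X ** (P ** U) ** X))"
      by (simp only: trace_sub[symmetric] matrix_sub_ldistrib matrix_sub_rdistrib)
    have "psd (P ** U)" unfolding U_def
      using psd_resolvent[OF P(1) G c] resolvent_push[OF P(1) G c] by simp
    moreover have "mH X = X" by (simp add: X_def mH_diff psdD G G0)
    ultimately have K: "psd (X ** (P ** U) ** X)" using psd_congruence[of "P ** U" X] by simp
    have E: "psd E" unfolding E_def
      using psd_congruence[of ?Ci "mH A"] hpd_imp_psd[OF hpd_inv(1)[OF C]] by simp
    have "psd (E ** (U0 ** G0) ** E)"
      using psd_congruence[OF psd_resolvent[OF G0 P(1) c], of E] psdD(1)[OF E] by (simp add: U0_def)
    \<comment> \<open>\<open>V0\<close> involves \<open>Q\<close> and \<open>U0\<close> involves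
      \<open>P\<close>, so symmetry of \<open>V0 E U0\<close> is hidden; \<open>Q = P + E\<close>
      rewrites it as this congruence.\<close>
    then have "psd (V0 ** (E + E ** (U0 ** G0) ** E) ** mH V0)"
      using E by (intro psd_congruence psd_add)
    moreover have "V0 ** (E + E ** (U0 ** G0) ** E) ** mH V0 = V0 ** E ** U0"
    proof -
      have W: "mH V0 = resolvent c G0 Q" unfolding V0_def by (rule mH_resolvent[OF Q G0 c])
      have "V0 ** (E + E ** (U0 ** G0) ** E) ** mH V0
        = V0 ** E ** (U0 ** (G0 ** P + c *\<^sub>R mat 1)) ** mH V0 + V0 ** E ** U0 ** G0 ** E ** mH V0"
        by (simp only: U0) (simp add: matrix_ring_simps)
      also have "\<dots> = V0 ** E ** U0 ** ((G0 ** Q + c *\<^sub>R mat 1) ** mH V0)"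
        by (simp add: PE matrix_ring_simps)
      finally show ?thesis by (simp add: W resolvent_cancel[OF G0 Q c])
    qed
    ultimately have "psd (V0 ** E ** U0)" by simp
    from trace_psd_mult_nonneg[OF this K] show ?thesis by (simp flip: tr)
  qed
  ultimately have "ln (Re (det Sg0)) - c * Re (trace (V0 ** E ** U0 ** X)) \<le> ln (Re (det Sg))"
  proof -
    assume a: "ln (Re (det Sg)) + ln (Re (det Y)) = 0"
      "ln (Re (det Y)) + ln (Re (det Sg0)) \<le> Re (trace (Y ** Sg0)) - of_nat CARD('n)"
      and t: "trace (Y ** Sg0) - of_nat CARD('n) = of_real c * trace (V0 ** E ** U ** X)"
      and l: "Re (trace (V0 ** E ** U ** X)) \<le> Re (trace (V0 ** E ** U0 ** X))"
    have "Re (trace (Y ** Sg0)) - of_nat CARD('n) = c * Re (trace (V0 ** E ** U ** X))"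
      using arg_cong[OF t, of Re] by simp
    also have "\<dots> \<le> c * Re (trace (V0 ** E ** U0 ** X))" using l c by simp
    finally show ?thesis using a by linarith
  qed
  then show ?thesis by (simp only: Sg0_def N0_def Sg_def V0_def U0_def X_def)
qed

subsection \<open>Averaging over the channel\<close>

text \<open>The positive and negative parts are compared separately. Integrability of
  \<open>g\<close> makes its parts finite, while the value of \<open>eexp\<close> may still be
  infinite.\<close>

lemma integral_le_eexp:
  assumes g: "integrable M g" and le: "\<And>w. g w \<le> f w"
  shows "ereal (\<integral>w. g w \<partial>M) \<le> eexp M f"
proof -
  let ?a = "\<integral>\<^sup>+ w. ennreal (g w) \<partial>M" and ?b = "\<integral>\<^sup>+ w. ennreal (- g w) \<partial>M"
  have fin: "?a < \<infinity>" "?b < \<infinity>"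
    using g by (auto simp: real_integrable_def top.not_eq_extremum)
  have e: "enn2ereal x = ereal (enn2real x)" if "x < \<infinity>" for x
    using that by (metis enn2ereal_ennreal enn2real_nonneg ennreal_enn2real infinity_ennreal_def)
  have "ereal (\<integral>w. g w \<partial>M) = enn2ereal ?a - enn2ereal ?b"
    by (simp add: real_lebesgue_integral_def[OF g] e[OF fin(1)] e[OF fin(2)])
  also have "\<dots> \<le> eexp M f"
    unfolding eexp_def using le
    by (intro ereal_minus_mono iffD1[OF less_eq_ennreal.rep_eq] nn_integral_mono ennreal_leI) auto
  finally show ?thesis .
qed

text \<open>For independent centred \<open>s\<close>, \<open>x\<close> with covariances
  \<open>S\<close>, \<open>Sg\<close>, the vectors \<open>F s + x\<close> and \<open>s + x\<close>
  have covariances \<open>C\<close> and \<open>S + Sg\<close> and cross-covariance \<open>A\<close>.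
  The Schur complement is the covariance of the residual
  \<open>(1 - mH Y F) s + (1 - mH Y) x\<close> with \<open>Y = matrix_inv C ** A\<close>.\<close>

lemma psd_schur_complement:
  fixes F S Sg :: "complex^'n^'n"
  assumes S: "psd S" and Sg: "hpd Sg"
  defines "A \<equiv> F ** S + Sg" and "C \<equiv> F ** S ** mH F + Sg"
  shows "hpd C" and "psd (S + Sg - mH A ** matrix_inv C ** A)"
proof -
  show C: "hpd C" unfolding C_def
    using hpd_add[OF Sg psd_congruence[OF S, of F]] by (simp add: add.commute)
  define Y where "Y = matrix_inv C ** A"
  note Ci = hpd_inv[OF C]
  have h: "mH (matrix_inv C) = matrix_inv C" using Ci(1) by (simp add: hpd_iff)
  have hS: "mH S = S" "mH Sg = Sg" using S Sg by (simp_all add: psdD hpd_iff)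
  have CY: "C ** Y = A" by (simp add: Y_def matrix_mul_assoc Ci)
  have YH: "mH Y = mH A ** matrix_inv C" by (simp add: Y_def mH_mult h)
  have AH: "mH A = S ** mH F + Sg" by (simp add: A_def mH_add mH_mult hS)
  \<comment> \<open>Completing the square writes the Schur complement as a sum of two congruences.\<close>
  let ?T = "mat 1 - mH Y ** F" and ?R = "mat 1 - mH Y"
  have p: "psd (?T ** S ** mH ?T + ?R ** Sg ** mH ?R)"
    by (intro psd_add psd_congruence S hpd_imp_psd[OF Sg])
  have "?T ** S ** mH ?T + ?R ** Sg ** mH ?R
      = S + Sg - mH Y ** A - mH A ** Y + mH Y ** (C ** Y)"
    unfolding AH by (simp add: A_def C_def mH_diff mH_mult matrix_ring_simps)
  also have "\<dots> = S + Sg - mH A ** Y" by (simp add: CY)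
  finally show "psd (S + Sg - mH A ** matrix_inv C ** A)"
    using p by (simp add: Y_def matrix_mul_assoc)
qed

text \<open>Moves the inverse from the receive to the transmit dimension, so that the channel enters
  only through its Gram matrix.\<close>

lemma gram_push_through:
  fixes H :: "complex^'n^'m" and Q :: "complex^'n^'n"
  assumes Q: "psd Q" and c: "0 < c"
  shows "mH H ** matrix_inv (H ** Q ** mH H + c *\<^sub>R mat 1) ** H = resolvent c (mH H ** H) Q ** (mH H ** H)"
proof -
  let ?G = "mH H ** H" and ?K = "H ** Q ** mH H + c *\<^sub>R mat 1"
  let ?M = "?G ** Q + c *\<^sub>R mat 1"
  have K: "?K ** matrix_inv ?K = mat 1"
    using resolvent_cancel(1)[OF psd_congruence[OF Q, of H] psd_one c] by (simp add: resolvent_def)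
  have "?M ** mH H = mH H ** ?K" by (simp add: matrix_ring_simps)
  then have "resolvent c ?G Q ** (?M ** mH H) ** matrix_inv ?K = resolvent c ?G Q ** (mH H ** ?K) ** matrix_inv ?K"
    by simp
  then have "(resolvent c ?G Q ** ?M) ** mH H ** matrix_inv ?K = resolvent c ?G Q ** mH H ** (?K ** matrix_inv ?K)"
    by (simp only: matrix_mul_assoc)
  then have "mH H ** matrix_inv ?K = resolvent c ?G Q ** mH H"
    by (simp add: K resolvent_cancel[OF psd_gram Q c])
  then show ?thesis by (simp add: matrix_mul_assoc)
qed

text \<open>The linear term of the supporting hyperplane has mean zero: the trace is a finite
  combination of entries, each centred at its mean.\<close>

lemma integral_trace_deviation:
  fixes H :: "'w \<Rightarrow> complex^'n^'m" and T :: "complex^'n^'n"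
  assumes "prob_space M"
    and int: "\<And>i j. integrable M (\<lambda>w. (mH (H w) ** H w) $ i $ j)"
  shows "integrable M (\<lambda>w. Re (trace (T ** (mH (H w) ** H w - Rg M H))))"
    and "(\<integral>w. Re (trace (T ** (mH (H w) ** H w - Rg M H))) \<partial>M) = 0"
proof -
  interpret prob_space M by fact
  let ?f = "\<lambda>w. trace (T ** (mH (H w) ** H w - Rg M H))"
  have eq: "?f = (\<lambda>w. \<Sum>i\<in>UNIV. \<Sum>k\<in>UNIV. T $ i $ k * ((mH (H w) ** H w) $ k $ i - Rg M H $ k $ i))"
    by (simp add: trace_def matrix_matrix_mult_def[of T])
  have i: "integrable M ?f" unfolding eq using int by auto
  have "integral\<^sup>L M ?f = (\<Sum>i\<in>UNIV. \<Sum>k\<in>UNIV. T $ i $ k * ((\<integral>w. (mH (H w) ** H w) $ k $ i \<partial>M) - Rg M H $ k $ i))"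
    unfolding eq using int by (simp add: Bochner_Integration.integral_sum prob_space)
  also have "\<dots> = 0" by (simp add: Rg_def)
  finally show "(\<integral>w. Re (?f w) \<partial>M) = 0" using i by simp
  show "integrable M (\<lambda>w. Re (?f w))" using i by simp
qed

theorem theorem2:
  fixes M :: "'w measure"
    and Sig :: "nat \<Rightarrow> complex^'nt^'nt"
    and F :: "complex^'nt^'nt"
    and H :: "'w \<Rightarrow> complex^'nt^'nr"
    and L l :: nat and N0 :: real
  assumes "L \<ge> 1" and "N0 > 0"
    and "\<And>t. t \<in> {1..L} \<Longrightarrow> hpd (Sig t)"
    and "l \<in> {1..L}"
    and "prob_space M"
    and "H \<in> borel_measurable M"
    and "\<And>i j. integrable M (\<lambda>w. (mH (H w) ** H w) $ i $ j)"
    and "hpd (Rg M H)"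
  shows "Rrate M Sig F L l N0 H \<le> ereal (Rupp M Sig F L l N0 H)"
proof -
  interpret prob_space M by fact
  define A B C S where "A = Amat Sig F l" and "B = Bmat Sig l" and "C = Cmat Sig F l"
    and "S = msum Sig {l+1..L}"
  define P Q where "P = Dmat Sig F l + S" and "Q = B + S"
  define G where "G w = mH (H w) ** H w" for w
  let ?G0 = "Rg M H"
  have sS: "psd (SigS Sig l)" unfolding SigS_def msum_def
    using assms(3,4) by (intro psd_sum hpd_imp_psd) auto
  have S: "psd S" unfolding S_def msum_def
    using assms(3,4) by (intro psd_sum hpd_imp_psd) auto
  have Sl: "hpd (Sig l)" using assms(3,4) by auto
  have C: "hpd C" unfolding C_def Cmat_def by (rule psd_schur_complement[OF sS Sl])
  have D: "psd (Dmat Sig F l)"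
    unfolding Dmat_def Amat_def Bmat_def Cmat_def by (rule psd_schur_complement[OF sS Sl])
  have P: "psd P" unfolding P_def by (intro psd_add D S)
  have Q: "psd Q" unfolding Q_def B_def Bmat_def by (intro psd_add sS S hpd_imp_psd[OF Sl])
  \<comment> \<open>The later-layer sum \<open>S\<close> is common to \<open>P\<close> and
    \<open>Q\<close>, so their difference is that of \<open>B\<close> and \<open>D\<close>.\<close>
  have PQ: "P = Q - mH A ** matrix_inv C ** A"
    by (simp add: P_def Q_def A_def B_def C_def Dmat_def)
  have G: "psd (G w)" for w unfolding G_def by (rule psd_gram)
  have G0: "psd ?G0" by (rule hpd_imp_psd) fact
  define J where "J X = C - A ** (resolvent N0 X Q ** X) ** mH A" for X
  have U: "SigU Sig F L l N0 (H w) = J (G w)" for w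
  proof -
    \<comment> \<open>The interference inside \<open>SigZ\<close> joins \<open>B\<close> to form
      \<open>Q\<close>, leaving only the noise term.\<close>
    have "H w ** Bmat Sig l ** mH (H w) + SigZ Sig L l N0 (H w) = H w ** Q ** mH (H w) + N0 *\<^sub>R mat 1"
      by (simp add: SigZ_def cI_def Q_def B_def S_def matrix_ring_simps)
    then have "SigU Sig F L l N0 (H w)
      = C - A ** (mH (H w) ** matrix_inv (H w ** Q ** mH (H w) + N0 *\<^sub>R mat 1) ** H w) ** mH A"
      by (simp add: SigU_def A_def C_def matrix_mul_assoc)
    then show ?thesis by (simp add: gram_push_through[OF Q assms(2)] J_def G_def)
  qed
  define T where "T = resolvent N0 Q ?G0 ** (mH A ** matrix_inv C ** A) ** resolvent N0 ?G0 P"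
  \<comment> \<open>The affine minorant, rescaled to base 2; its mean is its value at
    \<open>?G0\<close>.\<close>
  define g where "g w = (ln (Re (det (J ?G0))) - N0 * Re (trace (T ** (G w - ?G0)))) / ln 2" for w
  have "g w \<le> logdet2 (SigU Sig F L l N0 (H w))" for w
    using schur_tangent[OF C Q P PQ G G0 assms(2), of w]
    by (simp add: g_def logdet2_def log_def U J_def T_def divide_right_mono)
  note tr = integral_trace_deviation[OF assms(5,7), of T, folded G_def]
  moreover have "integrable M g" unfolding g_def using tr by auto
  moreover have "(\<integral>w. g w \<partial>M) = logdet2 (J ?G0)"
    unfolding g_def using tr by (simp add: logdet2_def log_def prob_space)
  ultimately have le: "ereal (logdet2 (J ?G0)) \<le> eexp M (\<lambda>w. logdet2 (SigU Sig F L l N0 (H w)))"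
    using integral_le_eexp[of M g] \<open>\<And>w. g w \<le> logdet2 (SigU Sig F L l N0 (H w))\<close> by metis
  have "logdet2 (J ?G0) = logdet2 C + (logdet2 (?G0 ** P + N0 *\<^sub>R cI) - logdet2 (?G0 ** Q + N0 *\<^sub>R cI))"
    using schur_det[OF C Q P PQ G0 assms(2)]
    by (simp add: logdet2_def log_def J_def cI_def add_divide_distrib diff_divide_distrib)
  then have "ereal (Rupp M Sig F L l N0 H) = ereal (logdet2 (Sig l)) - ereal (logdet2 (J ?G0))"
    by (simp add: Rupp_def C_def P_def Q_def S_def B_def)
  moreover have "Rrate M Sig F L l N0 H \<le> ereal (logdet2 (Sig l)) - ereal (logdet2 (J ?G0))"
    unfolding Rrate_def by (intro ereal_minus_mono order.refl le)
  ultimately show ?thesis by simp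
qed

end
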